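(* Let $p>3$ be a prime and let $G$ be an abelian group of order dividing $p^5$. Then \[ G\wedge G\cong \begin{cases} 1 & \text{if } G\cong G_1,\\ \mathbb{Z}_{p^2} & \text{if } G\cong G_{13},\\ \mathbb{Z}_{p} & \text{if } G\cong G_{26},\\ \mathbb{Z}_{p^2}\oplus\mathbb{Z}_{p}^{(2)} & \text{if } G\cong G_{43},\\ \mathbb{Z}_{p}^{(3)} & \text{if } G\cong G_{51},\\ \mathbb{Z}_{p}^{(6)} & \text{if } G\cong G_{66},\\ \mathbb{Z}_{p}^{(10)} & \text{if } G\cong G_{70}. \end{cases} \]
   Context: Notation: $\mathbb{Z}_n$ is the cyclic group of order $n$, and $A^{(n)}$ is the direct sum of $n$ copies of $A$. The groups are $G_1\cong\mathbb{Z}_{p^5}$, $G_{13}\cong\mathbb{Z}_{p^3}\times\mathbb{Z}_{p^2}$, $G_{26}\cong\mathbb{Z}_{p^4}\times\mathbb{Z}_p$, $G_{43}\cong\mathbb{Z}_{p^2}\times\mathbb{Z}_{p^2}\times\mathbb{Z}_p$, $G_{51}\cong\mathbb{Z}_{p^3}\times\mathbb{Z}_p\times\mathbb{Z}_p$, $G_{66}\cong\mathbb{Z}_{p^2}\times\mathbb{Z}_p\times\mathbb{Z}_p\times\mathbb{Z}_p$, $G_{70}\cong\mathbb{Z}_p^{(5)}$. For a group $G$ write ${}^{g}g'=gg'g^{-1}$. The non-abelian tensor square $G\otimes G$ is the group generated by symbols $g\otimes h$ ($g,h\in G$) subject to $gg'\otimes h=({}^{g}g'\otimes{}^{g}h)(g\otimes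 h)$ and $g\otimes hh'=(g\otimes h)({}^{h}g\otimes{}^{h}h')$ for all $g,g',h,h'\in G$. The non-abelian exterior square $G\wedge G$ is obtained by imposing the additional relations $g\otimes g=1$ for all $g\in G$. *)

theory Defs
  imports "HOL-Algebra.Product_Groups" "HOL-Computational_Algebra.Primes"
begin

section \<open>Groups given by generators and relations\<close>

text \<open>
  The letter \<open>(True, x)\<close> stands for the generator \<open>x\<close> and \<open>(False, x)\<close> for its formal inverse.
  A relation \<open>u = v\<close> is the pair \<open>(u, v)\<close>. The set of relations is only used on words over
  the given set of generators.
\<close>

type_synonym 'x group_word = "(bool \<times> 'x) list"

definition group_words :: "'x set \<Rightarrow> 'x group_word set"
  where "group_words X = lists (UNIV \<times> X)"

definition gen_word :: "'x list \<Rightarrow> 'x group_word"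
  where "gen_word xs = map (Pair True) xs"

inductive_set pres_cong :: "'x set \<Rightarrow> ('x group_word \<times> 'x group_word) set
    \<Rightarrow> ('x group_word \<times> 'x group_word) set"
  for X R where
  relator: "(u, v) \<in> R \<Longrightarrow> u \<in> group_words X \<Longrightarrow> v \<in> group_words X \<Longrightarrow> (u, v) \<in> pres_cong X R"
| cancel: "x \<in> X \<Longrightarrow> ([(b, x), (\<not> b, x)], []) \<in> pres_cong X R"
| refl: "u \<in> group_words X \<Longrightarrow> (u, u) \<in> pres_cong X R"
| sym: "(u, v) \<in> pres_cong X R \<Longrightarrow> (v, u) \<in> pres_cong X R"
| trans: "(u, v) \<in> pres_cong X R \<Longrightarrow> (v, w) \<in> pres_cong X R \<Longrightarrow> (u, w) \<in> pres_cong X R"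
| append: "(u, v) \<in> pres_cong X R \<Longrightarrow> (u', v') \<in> pres_cong X R
    \<Longrightarrow> (u @ u', v @ v') \<in> pres_cong X R"

definition presented_group :: "'x set \<Rightarrow> ('x group_word \<times> 'x group_word) set
    \<Rightarrow> 'x group_word set monoid"
  where "presented_group X R =
    \<lparr>carrier = group_words X // pres_cong X R,
     monoid.mult = (\<lambda>A B. \<Union>u\<in>A. \<Union>v\<in>B. pres_cong X R `` {u @ v}),
     one = pres_cong X R `` {[]}\<rparr>"

lemma pres_cong_in_words:
  "(u, v) \<in> pres_cong X R \<Longrightarrow> u \<in> group_words X \<and> v \<in> group_words X"
  by (induction rule: pres_cong.induct) (auto simp: group_words_def)

lemma equiv_pres_cong: "equiv (group_words X) (pres_cong X R)"
proof (rule equivI)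
  show "pres_cong X R \<subseteq> group_words X \<times> group_words X"
    using pres_cong_in_words by auto
  show "refl_on (group_words X) (pres_cong X R)"
    by (auto intro!: refl_onI pres_cong.refl)
  show "Relation.sym (pres_cong X R)"
    by (auto intro: symI pres_cong.sym)
  show "Relation.trans (pres_cong X R)"
    by (auto intro: transI pres_cong.trans)
qed

lemma mult_presented_group:
  assumes "u \<in> group_words X" "v \<in> group_words X"
  shows "(pres_cong X R `` {u}) \<otimes>\<^bsub>presented_group X R\<^esub> (pres_cong X R `` {v})
    = pres_cong X R `` {u @ v}"
proof -
  have "congruent2 (pres_cong X R) (pres_cong X R) (\<lambda>u v. pres_cong X R `` {u @ v})"
  proof (rule congruent2I')
    fix a b c d
    assume "(a, b) \<in> pres_cong X R" "(c, d) \<in> pres_cong X R"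
    then show "pres_cong X R `` {a @ c} = pres_cong X R `` {b @ d}"
      by (intro equiv_class_eq[OF equiv_pres_cong] pres_cong.append)
  qed
  from UN_equiv_class2[OF equiv_pres_cong equiv_pres_cong this assms] show ?thesis
    by (simp add: presented_group_def)
qed

lemma pres_cong_left_inverse:
  assumes "u \<in> group_words X"
  shows "\<exists>v \<in> group_words X. (v @ u, []) \<in> pres_cong X R"
  using assms
proof (induction u)
  case Nil
  then show ?case
    by (intro bexI[of _ "[]"]) (auto simp: group_words_def intro: pres_cong.refl)
next
  case (Cons l u)
  obtain b x where l: "l = (b, x)" and x: "x \<in> X" and u: "u \<in> group_words X"
    using Cons.prems by (cases l) (auto simp: group_words_def)
  from Cons.IH[OF u] obtain v where v: "v \<in> group_words X" "(v @ u, []) \<in> pres_cong X R"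
    by blast
  have "([(\<not> b, x), (b, x)], []) \<in> pres_cong X R"
    using pres_cong.cancel[OF x, of "\<not> b"] by simp
  from pres_cong.append[OF pres_cong.refl[OF v(1)]
      pres_cong.append[OF this pres_cong.refl[OF u]]]
  have "(v @ [(\<not> b, x), (b, x)] @ u, v @ u) \<in> pres_cong X R"
    by simp
  from pres_cong.trans[OF this v(2)]
  have "((v @ [(\<not> b, x)]) @ l # u, []) \<in> pres_cong X R"
    by (simp add: l)
  moreover have "v @ [(\<not> b, x)] \<in> group_words X"
    using v(1) x by (auto simp: group_words_def)
  ultimately show ?case by blast
qed

lemma group_presented_group: "group (presented_group X R)"
proof -
  let ?G = "presented_group X R" and ?c = "\<lambda>u. pres_cong X R `` {u}"
  have carr: "carrier ?G = ?c ` group_words X"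
    by (auto simp: presented_group_def quotient_def)
  have one: "\<one>\<^bsub>?G\<^esub> = ?c []"
    by (simp add: presented_group_def)
  have nil: "[] \<in> group_words X"
    by (simp add: group_words_def)
  have app: "u @ v \<in> group_words X" if "u \<in> group_words X" "v \<in> group_words X" for u v
    using that by (auto simp: group_words_def)
  show ?thesis
  proof (rule groupI)
    fix a assume "a \<in> carrier ?G"
    then obtain u where u: "u \<in> group_words X" "a = ?c u"
      by (auto simp: carr)
    obtain v where v: "v \<in> group_words X" "(v @ u, []) \<in> pres_cong X R"
      using pres_cong_left_inverse[OF u(1)] by blast
    have "?c v \<otimes>\<^bsub>?G\<^esub> a = \<one>\<^bsub>?G\<^esub>"
      using equiv_class_eq[OF equiv_pres_cong v(2)] u v(1) by (simp add: mult_presented_group one)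
    then show "\<exists>y\<in>carrier ?G. y \<otimes>\<^bsub>?G\<^esub> a = \<one>\<^bsub>?G\<^esub>"
      using v(1) by (auto simp: carr)
  qed (auto simp: carr one nil app mult_presented_group)
qed

section \<open>Non-abelian tensor and exterior squares\<close>

definition conj_act :: "('a, 'b) monoid_scheme \<Rightarrow> 'a \<Rightarrow> 'a \<Rightarrow> 'a"
  where "conj_act G g x = g \<otimes>\<^bsub>G\<^esub> x \<otimes>\<^bsub>G\<^esub> inv\<^bsub>G\<^esub> g"

text \<open>The pair \<open>(g, h)\<close> is the symbol usually written as the tensor of \<open>g\<close> and \<open>h\<close>.\<close>

definition tensor_rels :: "('a, 'b) monoid_scheme \<Rightarrow> (('a \<times> 'a) group_word \<times> ('a \<times> 'a) group_word) set"
  where "tensor_rels G =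
    {(gen_word [(g \<otimes>\<^bsub>G\<^esub> g', h)],
      gen_word [(conj_act G g g', conj_act G g h), (g, h)]) | g g' h.
        g \<in> carrier G \<and> g' \<in> carrier G \<and> h \<in> carrier G} \<union>
    {(gen_word [(g, h \<otimes>\<^bsub>G\<^esub> h')],
      gen_word [(g, h), (conj_act G h g, conj_act G h h')]) | g h h'.
        g \<in> carrier G \<and> h \<in> carrier G \<and> h' \<in> carrier G}"

definition tensor_square :: "('a, 'b) monoid_scheme \<Rightarrow> ('a \<times> 'a) group_word set monoid"
  where "tensor_square G = presented_group (carrier G \<times> carrier G) (tensor_rels G)"

definition exterior_square :: "('a, 'b) monoid_scheme \<Rightarrow> ('a \<times> 'a) group_word set monoid"
  where "exterior_square G = presented_group (carrier G \<times> carrier G)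
    (tensor_rels G \<union> {(gen_word [(g, g)], []) | g. g \<in> carrier G})"

section \<open>Direct sums of cyclic groups\<close>

abbreviation Zmod :: "nat \<Rightarrow> int monoid"
  where "Zmod \<equiv> integer_mod_group"

definition copies :: "nat \<Rightarrow> ('a, 'b) monoid_scheme \<Rightarrow> (nat \<Rightarrow> 'a) monoid"
  where "copies n A = sum_group {..<n} (\<lambda>_. A)"

end

theory Submission
  imports Defs "HOL-Algebra.Multiplicative_Group"
begin

text \<open>
  For abelian \<open>G\<close> all actions are trivial, so \<open>G \<and> G\<close> is the usual exterior square of a
  \<open>\<int>\<close>-module. If \<open>G\<close> has a basis \<open>a i\<close> of cyclic generators of orders \<open>m i\<close> with coordinate
  functions \<open>c i\<close>, then the \<open>2 \<times> 2\<close> minors \<open>c i g * c j h - c j g * c i h\<close> modulo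
  \<open>gcd (m i) (m j)\<close> are alternating and bimultiplicative, hence define coordinates on
  \<open>G \<and> G\<close>. They show that the elements \<open>a i \<and> a j\<close> with \<open>i < j\<close> form a basis of
  \<open>G \<and> G\<close> with orders \<open>gcd (m i) (m j)\<close>.
\<close>

section \<open>Homomorphisms out of presented groups\<close>

definition pres_gen :: "'x set \<Rightarrow> ('x group_word \<times> 'x group_word) set \<Rightarrow> 'x \<Rightarrow> 'x group_word set"
  where "pres_gen X R x = pres_cong X R `` {[(True, x)]}"

fun eval_word :: "('a, 'b) monoid_scheme \<Rightarrow> ('x \<Rightarrow> 'a) \<Rightarrow> 'x group_word \<Rightarrow> 'a" where
  "eval_word H f [] = \<one>\<^bsub>H\<^esub>"
| "eval_word H f ((b, x) # u) = (if b then f x else inv\<^bsub>H\<^esub> f x) \<otimes>\<^bsub>H\<^esub> eval_word H f u"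

lemma carrier_presented_group:
  "carrier (presented_group X R) = (\<lambda>u. pres_cong X R `` {u}) ` group_words X"
  by (auto simp: presented_group_def quotient_def)

lemma one_presented_group: "\<one>\<^bsub>presented_group X R\<^esub> = pres_cong X R `` {[]}"
  by (simp add: presented_group_def)

lemma pres_gen_closed: "x \<in> X \<Longrightarrow> pres_gen X R x \<in> carrier (presented_group X R)"
  by (auto simp: pres_gen_def carrier_presented_group group_words_def)

lemma class_inverse_letter:
  assumes "x \<in> X"
  shows "pres_cong X R `` {[(False, x)]} = inv\<^bsub>presented_group X R\<^esub> (pres_gen X R x)"
proof -
  interpret P: group "presented_group X R" by (rule group_presented_group)
  have w: "[(b, x)] \<in> group_words X" for b
    using assms by (simp add: group_words_def)
  have "pres_cong X R `` {[(False, x)]} \<otimes>\<^bsub>presented_group X R\<^esub> pres_gen X R x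
      = \<one>\<^bsub>presented_group X R\<^esub>"
    using equiv_class_eq[OF equiv_pres_cong pres_cong.cancel[OF assms, of False R]]
    by (simp add: pres_gen_def mult_presented_group w one_presented_group)
  moreover have "pres_cong X R `` {[(False, x)]} \<in> carrier (presented_group X R)"
    using w by (auto simp: carrier_presented_group)
  ultimately show ?thesis
    using P.inv_equality pres_gen_closed[OF assms] by metis
qed

text \<open>Induction on words: the class of \<open>l # u\<close> is the product of the classes of
  \<open>[l]\<close> and \<open>u\<close>, and the class of a single letter is a generator or the
  inverse of one.\<close>

lemma presented_group_hom_ext:
  assumes H: "group H"
    and f: "f \<in> hom (presented_group X R) H" and g: "g \<in> hom (presented_group X R) H"
    and eq: "\<And>x. x \<in> X \<Longrightarrow> f (pres_gen X R x) = g (pres_gen X R x)"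
    and z: "z \<in> carrier (presented_group X R)"
  shows "f z = g z"
proof -
  interpret P: group "presented_group X R" by (rule group_presented_group)
  interpret F: group_hom "presented_group X R" H f
    using H f by (simp add: group_hom_def group_hom_axioms_def P.group_axioms)
  interpret G: group_hom "presented_group X R" H g
    using H g by (simp add: group_hom_def group_hom_axioms_def P.group_axioms)
  have "f (pres_cong X R `` {u}) = g (pres_cong X R `` {u})" if "u \<in> group_words X" for u
    using that
  proof (induction u)
    case Nil
    then show ?case
      using F.hom_one G.hom_one by (simp add: one_presented_group)
  next
    case (Cons l u)
    obtain b x where l: "l = (b, x)" and x: "x \<in> X" and u: "u \<in> group_words X"
      and lw: "[l] \<in> group_words X"
      using Cons.prems by (cases l) (auto simp: group_words_def)
    have cl: "pres_cong X R `` {[l]} \<in> carrier (presented_group X R)"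
      "pres_cong X R `` {u} \<in> carrier (presented_group X R)"
      using u lw by (auto simp: carrier_presented_group)
    have "f (pres_cong X R `` {[l]}) = g (pres_cong X R `` {[l]})"
      using eq[OF x] pres_gen_closed[OF x, of R]
      by (cases b) (simp_all add: l class_inverse_letter[OF x] flip: pres_gen_def)
    moreover have "pres_cong X R `` {l # u}
        = pres_cong X R `` {[l]} \<otimes>\<^bsub>presented_group X R\<^esub> pres_cong X R `` {u}"
      using mult_presented_group[OF lw u] by simp
    ultimately show ?case
      using Cons.IH[OF u] cl by simp
  qed
  with z show ?thesis by (auto simp: carrier_presented_group)
qed

text \<open>Universal property of a presentation. \<open>eval_word H f\<close> turns concatenation
  into multiplication and respects the relations, so rule induction over \<open>pres_cong\<close>
  makes it constant on classes.\<close>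

lemma presented_group_hom_exists:
  assumes "group H" and f: "\<And>x. x \<in> X \<Longrightarrow> f x \<in> carrier H"
    and rel: "\<And>u v. (u, v) \<in> R \<Longrightarrow> u \<in> group_words X \<Longrightarrow> v \<in> group_words X
      \<Longrightarrow> eval_word H f u = eval_word H f v"
  shows "\<exists>h \<in> hom (presented_group X R) H. \<forall>x\<in>X. h (pres_gen X R x) = f x"
proof -
  interpret H: group H by fact
  have cl: "eval_word H f u \<in> carrier H" if "u \<in> group_words X" for u
    using that by (induction u) (auto simp: group_words_def f)
  have app: "eval_word H f (u @ v) = eval_word H f u \<otimes>\<^bsub>H\<^esub> eval_word H f v"
    if "u \<in> group_words X" "v \<in> group_words X" for u v
    using that(1)
  proof (induction u)
    case (Cons l u)
    then show ?case
      using cl[of u] cl[OF that(2)] by (cases l) (auto simp: group_words_def f H.m_assoc)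
  qed (use cl that in simp)
  have cong: "eval_word H f u = eval_word H f v" if "(u, v) \<in> pres_cong X R" for u v
    using that
  proof (induction rule: pres_cong.induct)
    case (append u v u' v')
    then show ?case by (simp add: app pres_cong_in_words)
  qed (auto simp: rel f)
  \<comment> \<open>A class is evaluated at an arbitrary representative; \<open>cong\<close> makes
    the choice irrelevant.\<close>
  define h where "h = (\<lambda>A. eval_word H f (SOME u. u \<in> A))"
  have h: "h (pres_cong X R `` {u}) = eval_word H f u" if "u \<in> group_words X" for u
  proof -
    have "u \<in> pres_cong X R `` {u}"
      using pres_cong.refl[OF that] by simp
    then have "(SOME v. v \<in> pres_cong X R `` {u}) \<in> pres_cong X R `` {u}"
      by (rule someI)
    then show ?thesis
      unfolding h_def using cong by (simp add: Image_def)
  qed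
  have "h \<in> hom (presented_group X R) H"
  proof (rule homI)
    fix A B assume "A \<in> carrier (presented_group X R)" "B \<in> carrier (presented_group X R)"
    then obtain u v where uv: "u \<in> group_words X" "v \<in> group_words X"
      "A = pres_cong X R `` {u}" "B = pres_cong X R `` {v}"
      by (auto simp: carrier_presented_group)
    moreover have "u @ v \<in> group_words X"
      using uv by (simp add: group_words_def)
    ultimately show "h (A \<otimes>\<^bsub>presented_group X R\<^esub> B) = h A \<otimes>\<^bsub>H\<^esub> h B"
      by (simp add: mult_presented_group h app)
  qed (auto simp: carrier_presented_group h cl)
  moreover have "h (pres_gen X R x) = f x" if "x \<in> X" for x
    using that h[of "[(True, x)]"] by (simp add: pres_gen_def group_words_def f)
  ultimately show ?thesis by blast
qed

lemma comm_presented_group: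
  assumes "\<And>x y. x \<in> X \<Longrightarrow> y \<in> X \<Longrightarrow>
    pres_gen X R x \<otimes>\<^bsub>presented_group X R\<^esub> pres_gen X R y
      = pres_gen X R y \<otimes>\<^bsub>presented_group X R\<^esub> pres_gen X R x"
  shows "comm_group (presented_group X R)"
proof -
  interpret P: group "presented_group X R" by (rule group_presented_group)
  let ?P = "presented_group X R"
  \<comment> \<open>Conjugation by an element commuting with all generators agrees with the identity on them.\<close>
  have central: "z \<otimes>\<^bsub>?P\<^esub> w = w \<otimes>\<^bsub>?P\<^esub> z"
    if z: "z \<in> carrier ?P" and w: "w \<in> carrier ?P"
      and gens: "\<And>x. x \<in> X \<Longrightarrow> z \<otimes>\<^bsub>?P\<^esub> pres_gen X R x = pres_gen X R x \<otimes>\<^bsub>?P\<^esub> z" for z w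
  proof -
    have "inv\<^bsub>?P\<^esub> z \<otimes>\<^bsub>?P\<^esub> (z \<otimes>\<^bsub>?P\<^esub> w) = w" if "w \<in> carrier ?P" for w
      using z that by (simp flip: P.m_assoc)
    then have "(\<lambda>w. z \<otimes>\<^bsub>?P\<^esub> w \<otimes>\<^bsub>?P\<^esub> inv\<^bsub>?P\<^esub> z) \<in> hom ?P ?P"
      using z by (intro homI) (simp_all add: P.m_assoc)
    moreover have "(\<lambda>w. w) \<in> hom ?P ?P"
      by (auto intro: homI)
    moreover have "z \<otimes>\<^bsub>?P\<^esub> pres_gen X R x \<otimes>\<^bsub>?P\<^esub> inv\<^bsub>?P\<^esub> z = pres_gen X R x" if "x \<in> X" for x
      using gens[OF that] z pres_gen_closed[OF that] by (simp add: P.m_assoc)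
    ultimately have "z \<otimes>\<^bsub>?P\<^esub> w \<otimes>\<^bsub>?P\<^esub> inv\<^bsub>?P\<^esub> z = w"
      using presented_group_hom_ext[OF P.group_axioms, of _ X R "\<lambda>w. w" w] w by blast
    then show ?thesis
      using z w by (simp add: P.inv_solve_right')
  qed
  show ?thesis
  proof (rule P.group_comm_groupI)
    fix z w assume zw: "z \<in> carrier ?P" "w \<in> carrier ?P"
    \<comment> \<open>\<open>central\<close> is used twice: first with a generator in the role of
      its \<open>z\<close>, so that generators commute with everything, and then with the given
      \<open>z\<close> itself.\<close>
    have "z \<otimes>\<^bsub>?P\<^esub> pres_gen X R x = pres_gen X R x \<otimes>\<^bsub>?P\<^esub> z" if "x \<in> X" for x
      using central[OF pres_gen_closed[OF that] zw(1)] assms that by metis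
    then show "z \<otimes>\<^bsub>?P\<^esub> w = w \<otimes>\<^bsub>?P\<^esub> z"
      by (rule central[OF zw])
  qed
qed

section \<open>Bases of abelian groups\<close>

lemma carrier_sum_group_finite:
  assumes "finite I" "\<And>i. i \<in> I \<Longrightarrow> group (A i)"
  shows "carrier (sum_group I A) = (\<Pi>\<^sub>E i\<in>I. carrier (A i))"
  using assms by (auto simp: carrier_sum_group)

text \<open>Allows the reduced integers that represent elements of \<open>Zmod n\<close> to serve as
  exponents of \<open>x\<close>.\<close>

lemma (in group) int_pow_cong:
  assumes "x \<in> carrier G" "x [^] n = \<one>" "k mod int n = l mod int n"
  shows "x [^] k = x [^] (l::int)"
proof -
  obtain t where "k = l + int n * t"
  proof -
    have "int n dvd k - l"
      using assms(3) by (simp add: mod_eq_dvd_iff)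
    then obtain t where "k - l = int n * t" ..
    then show ?thesis using that[of t] by simp
  qed
  then have "x [^] k = x [^] l \<otimes> (x [^] int n) [^] t"
    using assms(1) by (simp add: int_pow_mult int_pow_pow)
  then show ?thesis
    using assms by (simp add: int_pow_int)
qed

text \<open>A decomposition into cyclic groups is recorded by both directions of an isomorphism with
  \<open>sum_group\<close>: generators \<open>a i\<close> and coordinates \<open>c i\<close>. The
  coordinates are data because the minors are built from them. A modulus 0 stands for an infinite
  cyclic factor, and the reduction in \<open>coord_basis\<close> accounts for
  \<open>m i = 1\<close>, where 1 becomes 0.\<close>

locale cyclic_basis = comm_group G for G (structure) +
  fixes I :: "'i set" and m :: "'i \<Rightarrow> nat" and a :: "'i \<Rightarrow> 'a" and c :: "'i \<Rightarrow> 'a \<Rightarrow> int"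
  assumes finite_index: "finite I"
    and basis_closed [simp]: "i \<in> I \<Longrightarrow> a i \<in> carrier G"
    and basis_pow: "i \<in> I \<Longrightarrow> a i [^] m i = \<one>"
    and coord_hom: "i \<in> I \<Longrightarrow> c i \<in> hom G (Zmod (m i))"
    and coord_basis: "i \<in> I \<Longrightarrow> j \<in> I \<Longrightarrow> c i (a j) = (if i = j then 1 else 0) mod int (m i)"
    and span: "x \<in> carrier G \<Longrightarrow> x = (\<Otimes>i\<in>I. a i [^] c i x)"

text \<open>Stated outside \<open>cyclic_basis\<close> because it helps to establish
  \<open>span\<close> when such a basis is constructed. The induction runs over subsets
  \<open>J\<close> of \<open>I\<close>; the value is 0 until \<open>i\<close> enters
  \<open>J\<close>.\<close>

lemma hom_basis_prod:
  fixes G (structure)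
  assumes "comm_group G" "finite I" and a: "\<And>i. i \<in> I \<Longrightarrow> a i \<in> carrier G"
    and i: "i \<in> I" and h: "h \<in> hom G (Zmod m)"
    and ha: "\<And>j. j \<in> I \<Longrightarrow> h (a j) = (if i = j then 1 else 0) mod int m"
  shows "h (\<Otimes>j\<in>I. a j [^] (n j :: int)) = n i mod int m"
proof -
  interpret comm_group G by fact
  interpret h: group_hom G "Zmod m" h
    using h by (simp add: group_hom_def group_hom_axioms_def group_axioms)
  have "h (\<Otimes>j\<in>J. a j [^] n j) = (if i \<in> J then n i mod int m else 0)" if "J \<subseteq> I" for J
    using finite_subset[OF that \<open>finite I\<close>] that
  proof (induction J rule: finite_induct)
    case empty
    then show ?case using h.hom_one by simp
  next
    case (insert j J)
    have "h (\<Otimes>j\<in>insert j J. a j [^] n j) = h (a j [^] n j) \<otimes>\<^bsub>Zmod m\<^esub> h (\<Otimes>j\<in>J. a j [^] n j)"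
    proof -
      have "(\<Otimes>j\<in>J. a j [^] n j) \<in> carrier G" "a j [^] n j \<in> carrier G"
        using insert.prems a by (auto intro!: finprod_closed)
      moreover have "(\<Otimes>j\<in>insert j J. a j [^] n j) = a j [^] n j \<otimes> (\<Otimes>j\<in>J. a j [^] n j)"
        using insert a by (subst finprod_insert) auto
      ultimately show ?thesis by (simp only: h.hom_mult)
    qed
    also have "h (a j [^] n j) = (if i = j then n i mod int m else 0)"
      using insert.prems by (simp add: h.hom_int_pow a ha int_pow_integer_mod_group mod_mult_right_eq)
    finally show ?case
      using insert by auto
  qed
  from this[of I] i show ?thesis by simp
qed

context cyclic_basis
begin

lemma coord_prod:
  assumes "i \<in> I"
  shows "c i (\<Otimes>j\<in>I. a j [^] (n j :: int)) = n i mod int (m i)"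
  by (rule hom_basis_prod[OF comm_group_axioms finite_index basis_closed assms
        coord_hom[OF assms] coord_basis[OF assms]])

lemma hom_ext:
  assumes "group H" "f \<in> hom G H" "g \<in> hom G H" and eq: "\<And>i. i \<in> I \<Longrightarrow> f (a i) = g (a i)"
    and x: "x \<in> carrier G"
  shows "f x = g x"
proof -
  interpret f: group_hom G H f
    using assms by (simp add: group_hom_def group_hom_axioms_def group_axioms)
  interpret g: group_hom G H g
    using assms by (simp add: group_hom_def group_hom_axioms_def group_axioms)
  have "f (\<Otimes>j\<in>J. a j [^] c j x) = g (\<Otimes>j\<in>J. a j [^] c j x)" if "J \<subseteq> I" for J
    using finite_subset[OF that finite_index] that
  proof (induction J rule: finite_induct)
    case (insert j J)
    have *: "(\<Otimes>j\<in>insert j J. a j [^] c j x) = a j [^] c j x \<otimes> (\<Otimes>j\<in>J. a j [^] c j x)"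
      using insert by (subst finprod_insert) auto
    have "(\<Otimes>j\<in>J. a j [^] c j x) \<in> carrier G"
      using insert.prems by (auto intro!: finprod_closed)
    then show ?case
      using insert eq by (simp add: * f.hom_int_pow g.hom_int_pow)
  qed simp
  from this[of I] show ?thesis
    unfolding span[OF x, symmetric] by simp
qed

text \<open>The isomorphism is the tuple of coordinates: \<open>span\<close> recovers an element
  from it, and \<open>coord_prod\<close> shows that every tuple of residues occurs.\<close>

lemma iso_sum_group: "G \<cong> sum_group I (\<lambda>i. Zmod (m i))"
proof -
  let ?S = "sum_group I (\<lambda>i. Zmod (m i))"
  have carrier: "carrier ?S = (\<Pi>\<^sub>E i\<in>I. carrier (Zmod (m i)))"
    by (rule carrier_sum_group_finite) (simp_all add: finite_index)
  let ?F = "\<lambda>x. \<lambda>i\<in>I. c i x"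
  have "?F \<in> hom G ?S"
    using hom_in_carrier[OF coord_hom] hom_mult[OF coord_hom]
    by (auto intro!: homI simp: carrier)
  moreover have "inj_on ?F (carrier G)"
  proof (rule inj_onI)
    fix x y assume xy: "x \<in> carrier G" "y \<in> carrier G" "?F x = ?F y"
    have "c i x = c i y" if "i \<in> I" for i
      using fun_cong[OF xy(3), of i] that by simp
    then have "(\<Otimes>i\<in>I. a i [^] c i x) = (\<Otimes>i\<in>I. a i [^] c i y)"
      by (intro finprod_cong') auto
    then show "x = y"
      using span xy(1,2) by metis
  qed
  moreover have "t \<in> ?F ` carrier G" if t: "t \<in> carrier ?S" for t
  proof
    \<comment> \<open>Elements of \<open>Zmod\<close> are already reduced, so the \<open>mod\<close>
      in \<open>coord_prod\<close> leaves them unchanged.\<close>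
    have red: "t i mod int (m i) = t i" if "i \<in> I" for i
      using t that by (auto simp: carrier carrier_integer_mod_group PiE_iff split: if_splits)
    show "t = ?F (\<Otimes>i\<in>I. a i [^] t i)"
      using t by (auto simp: coord_prod red carrier PiE_iff extensional_def)
    show "(\<Otimes>i\<in>I. a i [^] t i) \<in> carrier G"
      by (auto intro!: finprod_closed)
  qed
  moreover have "?F ` carrier G \<subseteq> carrier ?S"
    using calculation(1) by (simp add: hom_def image_subset_iff_funcset)
  ultimately have "?F \<in> iso G ?S"
    by (intro isoI) (auto simp only: bij_betw_def)
  then show ?thesis by (rule is_isoI)
qed

end

text \<open>Converse of \<open>iso_sum_group\<close>: the \<open>a j\<close> are preimages of the
  unit vectors under an isomorphism, the coordinates are its components, and equations in
  \<open>G\<close> are checked component by component through \<open>inj\<close>.\<close>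

lemma sum_group_imp_cyclic_basis:
  fixes G (structure)
  assumes "comm_group G" "finite I" and iso: "G \<cong> sum_group I (\<lambda>i. Zmod (m i))"
  shows "\<exists>a c. cyclic_basis G I m a c"
proof -
  interpret comm_group G by fact
  let ?S = "sum_group I (\<lambda>i. Zmod (m i))"
  have carrier: "carrier ?S = (\<Pi>\<^sub>E i\<in>I. carrier (Zmod (m i)))"
    by (rule carrier_sum_group_finite) (simp_all add: \<open>finite I\<close>)
  obtain \<phi> where \<phi>: "\<phi> \<in> iso G ?S"
    using iso by (auto simp: is_iso_def)
  then have hom: "\<phi> \<in> hom G ?S" and bij: "bij_betw \<phi> (carrier G) (carrier ?S)"
    by (auto simp: iso_def)
  have c: "(\<lambda>x. \<phi> x i) \<in> hom G (Zmod (m i))" if "i \<in> I" for i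
    using hom that by (auto simp: hom_def carrier Pi_iff PiE_iff)
  have inj: "x = y" if "x \<in> carrier G" "y \<in> carrier G" "\<And>i. i \<in> I \<Longrightarrow> \<phi> x i = \<phi> y i" for x y
  proof (rule inj_onD[OF bij_betw_imp_inj_on[OF bij] _ that(1,2)])
    show "\<phi> x = \<phi> y"
      using hom_in_carrier[OF hom] that by (intro PiE_ext[of "\<phi> x" I _ "\<phi> y"]) (auto simp: carrier)
  qed
  \<comment> \<open>For \<open>j\<close> outside \<open>I\<close> the prescribed vector is zero, so
    the choice of \<open>a j\<close> below lies in \<open>G\<close> for every
    \<open>j\<close>.\<close>
  have ex: "\<exists>x \<in> carrier G. \<forall>i\<in>I. \<phi> x i = (if i = j then 1 else 0) mod int (m i)" for j
  proof -
    have "(\<lambda>i\<in>I. (if i = j then 1 else 0) mod int (m i)) \<in> \<phi> ` carrier G"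
      unfolding bij_betw_imp_surj_on[OF bij] by (simp add: carrier carrier_integer_mod_group)
    then obtain x where x: "(\<lambda>i\<in>I. (if i = j then 1 else 0) mod int (m i)) = \<phi> x" "x \<in> carrier G"
      by (rule imageE)
    have "\<phi> x i = (if i = j then 1 else 0) mod int (m i)" if "i \<in> I" for i
      using that by (simp flip: x(1))
    with x(2) show ?thesis by blast
  qed
  define a where "a = (\<lambda>j. SOME x. x \<in> carrier G \<and>
    (\<forall>i\<in>I. \<phi> x i = (if i = j then 1 else 0) mod int (m i)))"
  have "a j \<in> carrier G \<and> (\<forall>i\<in>I. \<phi> (a j) i = (if i = j then 1 else 0) mod int (m i))" for j
    unfolding a_def by (rule someI_ex) (use ex[of j] in blast)
  then have a: "a j \<in> carrier G"
    and \<phi>a: "i \<in> I \<Longrightarrow> \<phi> (a j) i = (if i = j then 1 else 0) mod int (m i)" for i j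
    by blast+
  have red: "\<phi> x i mod int (m i) = \<phi> x i" if "i \<in> I" "x \<in> carrier G" for x i
    using hom_in_carrier[OF c[OF that(1)] that(2)]
    by (auto simp: carrier_integer_mod_group split: if_splits)
  have "cyclic_basis G I m a (\<lambda>i x. \<phi> x i)"
  proof
    show "a i [^] m i = \<one>" if "i \<in> I" for i
    proof (rule inj)
      fix j assume j: "j \<in> I"
      interpret h: group_hom G "Zmod (m j)" "\<lambda>x. \<phi> x j"
        using c[OF j] by (simp add: group_hom_def group_hom_axioms_def group_axioms)
      show "\<phi> (a i [^] m i) j = \<phi> \<one> j"
        using h.hom_nat_pow[OF a, of i "m i"] h.hom_one j by (simp add: \<phi>a mod_mult_right_eq)
    qed (use a in auto)
    show "x = (\<Otimes>i\<in>I. a i [^] \<phi> x i)" if "x \<in> carrier G" for x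
    proof (rule inj)
      fix i assume i: "i \<in> I"
      have "\<phi> (\<Otimes>i\<in>I. a i [^] \<phi> x i) i = \<phi> x i mod int (m i)"
        by (rule hom_basis_prod[OF comm_group_axioms \<open>finite I\<close> a i c[OF i]]) (simp add: i \<phi>a)
      then show "\<phi> x i = \<phi> (\<Otimes>i\<in>I. a i [^] \<phi> x i) i"
        by (simp only: red[OF i that])
    qed (use a that in \<open>auto intro!: finprod_closed\<close>)
  qed (fact | simp add: a c \<phi>a)+
  then show ?thesis by blast
qed

section \<open>The exterior square of an abelian group\<close>

text \<open>Addition in \<open>Zmod n\<close> reduces modulo \<open>n\<close>, which the power of
  \<open>x\<close> does not see because \<open>x [^] n = \<one>\<close>.\<close>

lemma (in group) int_pow_coord_hom:
  assumes "x \<in> carrier G" "x [^] n = \<one>" "h \<in> hom H (Zmod n)"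
  shows "(\<lambda>z. x [^] h z) \<in> hom H G"
proof (rule homI)
  fix y z assume "y \<in> carrier H" "z \<in> carrier H"
  then have "h (y \<otimes>\<^bsub>H\<^esub> z) = (h y + h z) mod int n"
    using assms(3) by (simp add: hom_mult)
  then show "x [^] h (y \<otimes>\<^bsub>H\<^esub> z) = x [^] h y \<otimes> x [^] h z"
    using assms int_pow_cong[of x n "(h y + h z) mod int n" "h y + h z"]
    by (simp add: int_pow_mult)
qed (use assms in simp)

text \<open>The \<open>g\<close> inside the set of relations is bound by the comprehension and has
  nothing to do with the argument \<open>g\<close>.\<close>

definition wedge :: "('a, 'b) monoid_scheme \<Rightarrow> 'a \<Rightarrow> 'a \<Rightarrow> ('a \<times> 'a) group_word set"
  where "wedge G g h = pres_gen (carrier G \<times> carrier G)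
    (tensor_rels G \<union> {(gen_word [(g, g)], []) | g. g \<in> carrier G}) (g, h)"

section \<open>Bimultiplicativity, commutativity and universal property of the exterior
  square\<close>

context comm_group
begin

abbreviation "ext \<equiv> exterior_square G"

lemma conj_act_eq: "g \<in> carrier G \<Longrightarrow> x \<in> carrier G \<Longrightarrow> conj_act G g x = x"
  by (simp add: conj_act_def m_comm[of g x] m_assoc)

lemma group_ext: "group ext"
  unfolding exterior_square_def by (rule group_presented_group)

lemma wedge_closed [simp]: "g \<in> carrier G \<Longrightarrow> h \<in> carrier G \<Longrightarrow> wedge G g h \<in> carrier ext"
  unfolding wedge_def exterior_square_def by (rule pres_gen_closed) simp

text \<open>Transfers a defining relation from words to products of wedges. Folding over lists
  covers all three kinds of relation at once, including the empty right-hand side of the diagonal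
  ones.\<close>

lemma wedge_relation:
  fixes xs ys :: "('a \<times> 'a) list"
  defines "R \<equiv> tensor_rels G \<union> {(gen_word [(g, g)], []) | g. g \<in> carrier G}"
  assumes "(gen_word xs, gen_word ys) \<in> R" "set xs \<subseteq> carrier G \<times> carrier G" "set ys \<subseteq> carrier G \<times> carrier G"
  shows "foldr (\<lambda>(g, h) z. wedge G g h \<otimes>\<^bsub>ext\<^esub> z) xs \<one>\<^bsub>ext\<^esub>
    = foldr (\<lambda>(g, h) z. wedge G g h \<otimes>\<^bsub>ext\<^esub> z) ys \<one>\<^bsub>ext\<^esub>"
proof -
  let ?X = "carrier G \<times> carrier G"
  have words: "gen_word zs \<in> group_words ?X" if "set zs \<subseteq> ?X" for zs
    using that by (auto simp: gen_word_def group_words_def)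
  have fold: "pres_cong ?X R `` {gen_word zs} = foldr (\<lambda>(g, h) z. wedge G g h \<otimes>\<^bsub>ext\<^esub> z) zs \<one>\<^bsub>ext\<^esub>"
    if "set zs \<subseteq> ?X" for zs
    using that
  proof (induction zs)
    case Nil
    then show ?case
      by (simp add: gen_word_def exterior_square_def one_presented_group R_def)
  next
    case (Cons z zs)
    then have "pres_cong ?X R `` {gen_word (z # zs)}
        = pres_gen ?X R z \<otimes>\<^bsub>presented_group ?X R\<^esub> pres_cong ?X R `` {gen_word zs}"
      using words[of "[z]"] words[of zs] unfolding pres_gen_def
      by (subst mult_presented_group) (auto simp: gen_word_def)
    with Cons show ?case
      by (cases z) (simp add: wedge_def exterior_square_def R_def)
  qed
  have "pres_cong ?X R `` {gen_word xs} = pres_cong ?X R `` {gen_word ys}"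
    by (intro equiv_class_eq[OF equiv_pres_cong] pres_cong.relator words assms)
  then show ?thesis
    by (simp only: fold[OF assms(3)] fold[OF assms(4)])
qed

lemma tensor_relsI:
  assumes "x \<in> carrier G" "y \<in> carrier G" "z \<in> carrier G"
  shows "(gen_word [(x \<otimes> y, z)], gen_word [(conj_act G x y, conj_act G x z), (x, z)]) \<in> tensor_rels G"
    "(gen_word [(x, y \<otimes> z)], gen_word [(x, y), (conj_act G y x, conj_act G y z)]) \<in> tensor_rels G"
  using assms unfolding tensor_rels_def by blast+

text \<open>The factor with \<open>g'\<close> comes first, as in the tensor relation. This order
  matters until \<open>comm_group_ext\<close> is available, and its proof relies on it.\<close>

lemma wedge_mult_left:
  assumes "g \<in> carrier G" "g' \<in> carrier G" "h \<in> carrier G"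
  shows "wedge G (g \<otimes> g') h = wedge G g' h \<otimes>\<^bsub>ext\<^esub> wedge G g h"
proof -
  interpret E: group ext by (rule group_ext)
  have "(gen_word [(g \<otimes> g', h)], gen_word [(g', h), (g, h)]) \<in> tensor_rels G"
    using tensor_relsI(1)[OF assms] assms by (simp add: conj_act_eq)
  with wedge_relation[of "[(g \<otimes> g', h)]" "[(g', h), (g, h)]"] assms show ?thesis by simp
qed

lemma wedge_mult_right:
  assumes "g \<in> carrier G" "h \<in> carrier G" "h' \<in> carrier G"
  shows "wedge G g (h \<otimes> h') = wedge G g h \<otimes>\<^bsub>ext\<^esub> wedge G g h'"
proof -
  interpret E: group ext by (rule group_ext)
  have "(gen_word [(g, h \<otimes> h')], gen_word [(g, h), (g, h')]) \<in> tensor_rels G"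
    using tensor_relsI(2)[OF assms] assms by (simp add: conj_act_eq)
  with wedge_relation[of "[(g, h \<otimes> h')]" "[(g, h), (g, h')]"] assms show ?thesis by simp
qed

lemma wedge_self [simp]:
  assumes "g \<in> carrier G"
  shows "wedge G g g = \<one>\<^bsub>ext\<^esub>"
proof -
  interpret E: group ext by (rule group_ext)
  show ?thesis
    using wedge_relation[of "[(g, g)]" "[]"] assms by (auto simp: gen_word_def)
qed

lemma comm_group_ext: "comm_group ext"
proof -
  interpret E: group ext by (rule group_ext)
  \<comment> \<open>Expand the wedge of \<open>g \<otimes> g'\<close> and \<open>h' \<otimes> h\<close> in both orders and cancel.\<close>
  have "wedge G g h' \<otimes>\<^bsub>ext\<^esub> wedge G g' h = wedge G g' h \<otimes>\<^bsub>ext\<^esub> wedge G g h'"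
    if cl: "g \<in> carrier G" "h \<in> carrier G" "g' \<in> carrier G" "h' \<in> carrier G" for g h g' h'
  proof -
    let ?a = "wedge G g h'" and ?b = "wedge G g h" and ?c = "wedge G g' h'" and ?d = "wedge G g' h"
    have "?c \<otimes>\<^bsub>ext\<^esub> (?d \<otimes>\<^bsub>ext\<^esub> (?a \<otimes>\<^bsub>ext\<^esub> ?b)) = wedge G g' (h' \<otimes> h) \<otimes>\<^bsub>ext\<^esub> wedge G g (h' \<otimes> h)"
      using cl by (simp add: wedge_mult_right E.m_assoc)
    also have "\<dots> = wedge G (g \<otimes> g') (h' \<otimes> h)"
      using cl by (simp add: wedge_mult_left)
    also have "\<dots> = wedge G (g \<otimes> g') h' \<otimes>\<^bsub>ext\<^esub> wedge G (g \<otimes> g') h"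
      using cl by (simp add: wedge_mult_right)
    also have "\<dots> = ?c \<otimes>\<^bsub>ext\<^esub> (?a \<otimes>\<^bsub>ext\<^esub> (?d \<otimes>\<^bsub>ext\<^esub> ?b))"
      using cl by (simp add: wedge_mult_left E.m_assoc)
    finally have "(?d \<otimes>\<^bsub>ext\<^esub> ?a) \<otimes>\<^bsub>ext\<^esub> ?b = (?a \<otimes>\<^bsub>ext\<^esub> ?d) \<otimes>\<^bsub>ext\<^esub> ?b"
      using cl by (simp add: E.m_assoc)
    then show ?thesis
      using cl by simp
  qed
  then show ?thesis
    unfolding exterior_square_def wedge_def by (intro comm_presented_group) auto
qed

lemma wedge_hom_left:
  assumes "h \<in> carrier G"
  shows "(\<lambda>g. wedge G g h) \<in> hom G ext"
proof -
  interpret E: comm_group ext by (rule comm_group_ext)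
  show ?thesis using assms by (auto intro!: homI simp: wedge_mult_left E.m_comm)
qed

lemma wedge_hom_right: "g \<in> carrier G \<Longrightarrow> wedge G g \<in> hom G ext"
  by (auto intro!: homI simp: wedge_mult_right)

lemma wedge_antisym:
  assumes "g \<in> carrier G" "h \<in> carrier G"
  shows "wedge G h g = inv\<^bsub>ext\<^esub> wedge G g h"
proof -
  interpret E: comm_group ext by (rule comm_group_ext)
  have "\<one>\<^bsub>ext\<^esub> = wedge G (g \<otimes> h) (g \<otimes> h)"
    using assms by (simp del: wedge_self add: wedge_self[of "g \<otimes> h"])
  \<comment> \<open>Only the diagonal terms in \<open>g\<close> and in \<open>h\<close> are
    cancelled; the general rule \<open>wedge_self\<close> is switched off so that the left side is
    expanded instead of collapsing to the identity.\<close>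
  also have "\<dots> = wedge G h g \<otimes>\<^bsub>ext\<^esub> wedge G g h"
    using assms
    by (simp del: wedge_self add: wedge_mult_left wedge_mult_right wedge_self[of g] wedge_self[of h])
  finally show ?thesis
    using assms by (intro E.inv_equality[symmetric]) auto
qed

lemma ext_hom_ext:
  assumes "group H" "f \<in> hom ext H" "f' \<in> hom ext H"
    and "\<And>g h. g \<in> carrier G \<Longrightarrow> h \<in> carrier G \<Longrightarrow> f (wedge G g h) = f' (wedge G g h)"
    and "z \<in> carrier ext"
  shows "f z = f' z"
proof (rule presented_group_hom_ext[OF assms(1) assms(2,3)[unfolded exterior_square_def]
      _ assms(5)[unfolded exterior_square_def]])
  show "f (pres_gen (carrier G \<times> carrier G)
      (tensor_rels G \<union> {(gen_word [(g, g)], []) | g. g \<in> carrier G}) x)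
    = f' (pres_gen (carrier G \<times> carrier G)
      (tensor_rels G \<union> {(gen_word [(g, g)], []) | g. g \<in> carrier G}) x)"
    if "x \<in> carrier G \<times> carrier G" for x
    using assms(4)[of "fst x" "snd x"] that by (auto simp: wedge_def)
qed

text \<open>Universal property for alternating bimultiplicative maps. Commutativity of
  \<open>H\<close> absorbs the reversed order of factors in the first tensor relation.\<close>

lemma ext_hom_exists:
  assumes "comm_group H" and cl: "\<And>g h. g \<in> carrier G \<Longrightarrow> h \<in> carrier G \<Longrightarrow> b g h \<in> carrier H"
    and left: "\<And>g g' h. g \<in> carrier G \<Longrightarrow> g' \<in> carrier G \<Longrightarrow> h \<in> carrier G
      \<Longrightarrow> b (g \<otimes> g') h = b g h \<otimes>\<^bsub>H\<^esub> b g' h"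
    and right: "\<And>g h h'. g \<in> carrier G \<Longrightarrow> h \<in> carrier G \<Longrightarrow> h' \<in> carrier G
      \<Longrightarrow> b g (h \<otimes> h') = b g h \<otimes>\<^bsub>H\<^esub> b g h'"
    and self: "\<And>g. g \<in> carrier G \<Longrightarrow> b g g = \<one>\<^bsub>H\<^esub>"
  shows "\<exists>f \<in> hom ext H. \<forall>g\<in>carrier G. \<forall>h\<in>carrier G. f (wedge G g h) = b g h"
proof -
  interpret H: comm_group H by fact
  have "\<exists>f \<in> hom ext H. \<forall>x\<in>carrier G \<times> carrier G. f (pres_gen (carrier G \<times> carrier G)
    (tensor_rels G \<union> {(gen_word [(g, g)], []) | g. g \<in> carrier G}) x) = (case x of (g, h) \<Rightarrow> b g h)"
    unfolding exterior_square_def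
  proof (rule presented_group_hom_exists[OF H.group_axioms])
    fix u v assume "(u, v) \<in> tensor_rels G \<union> {(gen_word [(g, g)], []) | g. g \<in> carrier G}"
    then show "eval_word H (\<lambda>(g, h). b g h) u = eval_word H (\<lambda>(g, h). b g h) v"
      unfolding tensor_rels_def
      by (auto simp: gen_word_def conj_act_eq left right self cl H.m_comm)
  qed (use cl in auto)
  then show ?thesis by (simp add: wedge_def)
qed

end

section \<open>Minors as coordinates, and the basis of the exterior square\<close>

lemma mod_mod_gcd:
  fixes x :: int
  shows "x mod int m mod int (gcd m n) = x mod int (gcd m n)"
    "x mod int n mod int (gcd m n) = x mod int (gcd m n)"
  by (simp_all add: mod_mod_cancel)

text \<open>The linear order on the indices serves to select one of the two pairs
  \<open>(i, j)\<close> and \<open>(j, i)\<close>, whose wedges are inverse to each other.\<close>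

locale ordered_cyclic_basis = cyclic_basis G I m a c for G (structure) and I :: "'i :: linorder set" and m a c
begin

definition pairs :: "('i \<times> 'i) set"
  where "pairs = {(i, j). i \<in> I \<and> j \<in> I \<and> i < j}"

abbreviation pair_mod :: "'i \<times> 'i \<Rightarrow> nat"
  where "pair_mod \<equiv> \<lambda>(i, j). gcd (m i) (m j)"

abbreviation pair_wedge :: "'i \<times> 'i \<Rightarrow> ('a \<times> 'a) group_word set"
  where "pair_wedge \<equiv> \<lambda>(i, j). wedge G (a i) (a j)"

lemma coord_mult_mod:
  assumes "i \<in> I" "g \<in> carrier G" "g' \<in> carrier G" "d dvd int (m i)"
  shows "c i (g \<otimes> g') mod d = (c i g + c i g') mod d"
  using assms hom_mult[OF coord_hom[OF assms(1)] assms(2,3)] by (simp add: mod_mod_cancel)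

text \<open>\<open>c i\<close> is additive modulo \<open>m i\<close> and \<open>c j\<close> modulo
  \<open>m j\<close>, so the minor is bimultiplicative modulo any common divisor. It vanishes on the
  diagonal because integers commute.\<close>

lemma ext_coord_exists:
  assumes ij: "i \<in> I" "j \<in> I"
  shows "\<exists>f \<in> hom ext (Zmod (gcd (m i) (m j))). \<forall>g\<in>carrier G. \<forall>h\<in>carrier G.
    f (wedge G g h) = (c i g * c j h - c j g * c i h) mod int (gcd (m i) (m j))"
proof (rule ext_hom_exists)
  let ?d = "int (gcd (m i) (m j))"
  have d: "?d dvd int (m i)" "?d dvd int (m j)"
    by simp_all
  note ci = coord_mult_mod[OF ij(1) _ _ d(1)] and cj = coord_mult_mod[OF ij(2) _ _ d(2)]
  show "(c i g * c j h - c j g * c i h) mod ?d \<in> carrier (Zmod (gcd (m i) (m j)))" for g h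
    by (simp add: carrier_integer_mod_group)
  show "(c i (g \<otimes> g') * c j h - c j (g \<otimes> g') * c i h) mod ?d
      = (c i g * c j h - c j g * c i h) mod ?d
        \<otimes>\<^bsub>Zmod (gcd (m i) (m j))\<^esub> ((c i g' * c j h - c j g' * c i h) mod ?d)"
    if "g \<in> carrier G" "g' \<in> carrier G" "h \<in> carrier G" for g g' h
  proof -
    have "(c i (g \<otimes> g') * c j h - c j (g \<otimes> g') * c i h) mod ?d
      = ((c i g + c i g') * c j h - (c j g + c j g') * c i h) mod ?d"
      by (intro mod_diff_cong mod_mult_cong) (simp_all only: ci cj that)
    also have "\<dots> = ((c i g * c j h - c j g * c i h) + (c i g' * c j h - c j g' * c i h)) mod ?d"
      by (simp add: algebra_simps)
    finally show ?thesis
      by (simp only: mult_integer_mod_group mod_add_eq)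
  qed
  show "(c i g * c j (h \<otimes> h') - c j g * c i (h \<otimes> h')) mod ?d
      = (c i g * c j h - c j g * c i h) mod ?d
        \<otimes>\<^bsub>Zmod (gcd (m i) (m j))\<^esub> ((c i g * c j h' - c j g * c i h') mod ?d)"
    if "g \<in> carrier G" "h \<in> carrier G" "h' \<in> carrier G" for g h h'
  proof -
    have "(c i g * c j (h \<otimes> h') - c j g * c i (h \<otimes> h')) mod ?d
      = (c i g * (c j h + c j h') - c j g * (c i h + c i h')) mod ?d"
      by (intro mod_diff_cong mod_mult_cong) (simp_all only: ci cj that)
    also have "\<dots> = ((c i g * c j h - c j g * c i h) + (c i g * c j h' - c j g * c i h')) mod ?d"
      by (simp add: algebra_simps)
    finally show ?thesis
      by (simp only: mult_integer_mod_group mod_add_eq)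
  qed
qed (simp_all add: mult.commute)

text \<open>Linearity in the left argument kills the wedge by \<open>m i\<close>, in the right
  argument by \<open>m j\<close>; its order therefore divides both.\<close>

lemma pair_wedge_pow:
  assumes "i \<in> I" "j \<in> I"
  shows "wedge G (a i) (a j) [^]\<^bsub>ext\<^esub> gcd (m i) (m j) = \<one>\<^bsub>ext\<^esub>"
proof -
  interpret E: comm_group ext by (rule comm_group_ext)
  interpret l: group_hom G ext "\<lambda>g. wedge G g (a j)"
    using assms by (simp add: group_hom_def group_hom_axioms_def wedge_hom_left E.group_axioms group_axioms)
  interpret r: group_hom G ext "wedge G (a i)"
    using assms by (simp add: group_hom_def group_hom_axioms_def wedge_hom_right E.group_axioms group_axioms)
  have "wedge G (a i) (a j) [^]\<^bsub>ext\<^esub> m i = \<one>\<^bsub>ext\<^esub>"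
    using l.hom_nat_pow[of "a i" "m i"] l.hom_one assms by (simp add: basis_pow)
  moreover have "wedge G (a i) (a j) [^]\<^bsub>ext\<^esub> m j = \<one>\<^bsub>ext\<^esub>"
    using r.hom_nat_pow[of "a j" "m j"] r.hom_one assms by (simp add: basis_pow)
  ultimately show ?thesis
    using assms by (simp add: E.pow_eq_id)
qed

theorem cyclic_basis_ext: "\<exists>\<chi>. cyclic_basis ext pairs pair_mod pair_wedge \<chi>"
proof -
  interpret E: comm_group ext by (rule comm_group_ext)
  have fin: "finite pairs"
    by (rule finite_subset[of _ "I \<times> I"]) (auto simp: pairs_def finite_index)
  have "\<forall>p\<in>pairs. \<exists>f. f \<in> hom ext (Zmod (pair_mod p)) \<and> (\<forall>g\<in>carrier G. \<forall>h\<in>carrier G.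
    f (wedge G g h) = (c (fst p) g * c (snd p) h - c (snd p) g * c (fst p) h) mod int (pair_mod p))"
    using ext_coord_exists by (fastforce simp: pairs_def)
  from bchoice[OF this] obtain \<chi> where \<chi>: "\<And>p. p \<in> pairs \<Longrightarrow> \<chi> p \<in> hom ext (Zmod (pair_mod p))"
    and \<chi>_wedge: "\<And>p g h. p \<in> pairs \<Longrightarrow> g \<in> carrier G \<Longrightarrow> h \<in> carrier G \<Longrightarrow>
      \<chi> p (wedge G g h) = (c (fst p) g * c (snd p) h - c (snd p) g * c (fst p) h) mod int (pair_mod p)"
    by blast
  have closed: "pair_wedge p \<in> carrier ext" if "p \<in> pairs" for p
    using that by (auto simp: pairs_def)
  have pow: "pair_wedge p [^]\<^bsub>ext\<^esub> pair_mod p = \<one>\<^bsub>ext\<^esub>" if "p \<in> pairs" for p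
    using that by (auto simp: pairs_def pair_wedge_pow)
  have \<chi>_basis: "\<chi> p (pair_wedge q) = (if p = q then 1 else 0) mod int (pair_mod p)"
    if pq: "p \<in> pairs" "q \<in> pairs" for p q
  proof -
    obtain i j k l where ij: "p = (i, j)" "i \<in> I" "j \<in> I" "i < j"
      and kl: "q = (k, l)" "k \<in> I" "l \<in> I" "k < l"
      using pq by (auto simp: pairs_def)
    let ?\<delta> = "\<lambda>x y. if x = y then 1 else 0 :: int"
    have "\<chi> p (pair_wedge q) = (c i (a k) * c j (a l) - c j (a k) * c i (a l)) mod int (gcd (m i) (m j))"
      using \<chi>_wedge[OF pq(1), of "a k" "a l"] ij kl by simp
    also have "\<dots> = (?\<delta> i k * ?\<delta> j l - ?\<delta> j k * ?\<delta> i l) mod int (gcd (m i) (m j))"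
      using ij kl by (intro mod_diff_cong mod_mult_cong) (simp_all only: coord_basis mod_mod_gcd)
    \<comment> \<open>The second product is always 0: \<open>j = k\<close> and \<open>i = l\<close>
      would give \<open>i < j\<close> and \<open>j < i\<close>. The first is 1 exactly when the two
      pairs coincide.\<close>
    also have "?\<delta> i k * ?\<delta> j l - ?\<delta> j k * ?\<delta> i l = (if p = q then 1 else 0)"
      using ij kl by auto
    finally show ?thesis using ij by simp
  qed
  \<comment> \<open>\<open>F\<close> expands \<open>z\<close> in the candidate basis, so the
    remaining axiom \<open>span\<close> says that \<open>F\<close> is the identity. As
    \<open>F\<close> is a homomorphism, this can be tested on wedges.\<close>
  define F where "F = (\<lambda>z. \<Otimes>\<^bsub>ext\<^esub>p\<in>pairs. pair_wedge p [^]\<^bsub>ext\<^esub> \<chi> p z)"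
  have F_hom: "F \<in> hom ext ext"
  proof (rule homI)
    fix y z assume yz: "y \<in> carrier ext" "z \<in> carrier ext"
    have "F (y \<otimes>\<^bsub>ext\<^esub> z)
        = (\<Otimes>\<^bsub>ext\<^esub>p\<in>pairs. pair_wedge p [^]\<^bsub>ext\<^esub> \<chi> p y \<otimes>\<^bsub>ext\<^esub> pair_wedge p [^]\<^bsub>ext\<^esub> \<chi> p z)"
      unfolding F_def using closed yz
      by (intro E.finprod_cong' refl hom_mult[OF E.int_pow_coord_hom[OF closed pow \<chi>]]) auto
    then show "F (y \<otimes>\<^bsub>ext\<^esub> z) = F y \<otimes>\<^bsub>ext\<^esub> F z"
      unfolding F_def using closed by (simp add: E.finprod_multf)
  qed (use closed in \<open>auto simp: F_def intro!: E.finprod_closed\<close>)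
  interpret F: group_hom ext ext F
    using F_hom by (simp add: group_hom_def group_hom_axioms_def E.group_axioms)
  have F_pair: "F (pair_wedge q) = pair_wedge q" if q: "q \<in> pairs" for q
  proof -
    \<comment> \<open>The coordinate is a reduced residue, which is 0 even for \<open>p = q\<close>
      if the modulus is 1; \<open>int_pow_cong\<close> replaces it by the plain Kronecker
      delta.\<close>
    have "pair_wedge p [^]\<^bsub>ext\<^esub> \<chi> p (pair_wedge q) = pair_wedge p [^]\<^bsub>ext\<^esub> (if p = q then 1 else 0 :: int)"
      if "p \<in> pairs" for p
      using that q by (intro E.int_pow_cong[OF closed pow]) (simp_all add: \<chi>_basis)
    then have "F (pair_wedge q) = (\<Otimes>\<^bsub>ext\<^esub>p\<in>pairs. if p = q then pair_wedge p else \<one>\<^bsub>ext\<^esub>)"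
      unfolding F_def using closed by (intro E.finprod_cong') auto
    then show ?thesis
      using E.finprod_singleton_swap[OF q fin, of pair_wedge] closed by auto
  qed
  have F_basis: "F (wedge G (a k) (a l)) = wedge G (a k) (a l)" if kl: "k \<in> I" "l \<in> I" for k l
  proof (cases k l rule: linorder_cases)
    case less
    then show ?thesis using F_pair[of "(k, l)"] kl by (simp add: pairs_def)
  next
    case equal
    then show ?thesis using kl F.hom_one by simp
  next
    case greater
    then show ?thesis
      using F_pair[of "(l, k)"] kl by (simp add: pairs_def wedge_antisym[of "a l" "a k"])
  qed
  \<comment> \<open>The identity spreads from basis wedges to all wedges one argument at a time:
    with the other argument fixed, both sides are homomorphisms on \<open>G\<close> that agree on
    the basis.\<close>
  have F_right: "F (wedge G (a k) h) = wedge G (a k) h" if "k \<in> I" "h \<in> carrier G" for k h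
    using hom_ext[OF E.group_axioms hom_compose[OF wedge_hom_right F_hom] wedge_hom_right, of "a k" "a k" h]
      F_basis that by (simp add: compose_def)
  have F_wedge: "F (wedge G g h) = wedge G g h" if "g \<in> carrier G" "h \<in> carrier G" for g h
    using hom_ext[OF E.group_axioms hom_compose[OF wedge_hom_left F_hom] wedge_hom_left, of h h g]
      F_right that by (simp add: compose_def)
  have F_id: "F z = z" if "z \<in> carrier ext" for z
    using ext_hom_ext[OF E.group_axioms F_hom _ _ that, of "\<lambda>z. z"] F_wedge by (simp add: hom_def)
  have "cyclic_basis ext pairs pair_mod pair_wedge \<chi>"
  proof
    show "z = (\<Otimes>\<^bsub>ext\<^esub>p\<in>pairs. pair_wedge p [^]\<^bsub>ext\<^esub> \<chi> p z)" if "z \<in> carrier ext" for z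
      using F_id[OF that] by (simp add: F_def)
  qed (fact fin closed pow \<chi> \<chi>_basis)+
  then show ?thesis by blast
qed

end

theorem exterior_square_sum_group:
  fixes I :: "'i :: linorder set"
  assumes "comm_group G" "finite I" "G \<cong> sum_group I (\<lambda>i. Zmod (m i))"
  shows "exterior_square G \<cong> sum_group {(i, j). i \<in> I \<and> j \<in> I \<and> i < j} (\<lambda>(i, j). Zmod (gcd (m i) (m j)))"
proof -
  obtain a c where "cyclic_basis G I m a c"
    using sum_group_imp_cyclic_basis[OF assms] by blast
  then interpret ordered_cyclic_basis G I m a c
    by (simp add: ordered_cyclic_basis_def)
  from cyclic_basis_ext obtain \<chi> where "cyclic_basis ext pairs pair_mod pair_wedge \<chi>" ..
  from cyclic_basis.iso_sum_group[OF this] show ?thesis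
    by (simp add: pairs_def case_prod_unfold)
qed

section \<open>Rearranging direct sums\<close>

lemma sum_group_singleton_iso:
  assumes "group (A i)"
  shows "A i \<cong> sum_group {i} A"
proof -
  have carrier: "carrier (sum_group {i} A) = (\<Pi>\<^sub>E j\<in>{i}. carrier (A j))"
    by (rule carrier_sum_group_finite) (use assms in auto)
  have "(\<lambda>x. \<lambda>j\<in>{i}. x) \<in> iso (A i) (sum_group {i} A)"
  proof (rule isoI)
    show "(\<lambda>x. \<lambda>j\<in>{i}. x) \<in> hom (A i) (sum_group {i} A)"
      by (auto intro!: homI simp: carrier)
    show "bij_betw (\<lambda>x. \<lambda>j\<in>{i}. x) (carrier (A i)) (carrier (sum_group {i} A))"
      by (rule bij_betw_byWitness[where f' = "\<lambda>y. y i"])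
        (auto simp: carrier PiE_iff extensional_def split: if_splits)
  qed
  then show ?thesis by (rule is_isoI)
qed

lemma DirProd_iso_sum_group_insert:
  assumes "finite I" "i \<notin> I" "\<And>j. j \<in> insert i I \<Longrightarrow> group (A j)"
  shows "A i \<times>\<times> sum_group I A \<cong> sum_group (insert i I) A"
proof -
  have carrier: "carrier (sum_group I A) = (\<Pi>\<^sub>E j\<in>I. carrier (A j))"
    "carrier (sum_group (insert i I) A) = (\<Pi>\<^sub>E j\<in>insert i I. carrier (A j))"
    using assms by (auto simp only: intro!: carrier_sum_group_finite)
  let ?F = "\<lambda>(u, y). \<lambda>j\<in>insert i I. if j = i then u else y j"
  have "?F \<in> iso (A i \<times>\<times> sum_group I A) (sum_group (insert i I) A)"
  proof (rule isoI)
    have closed: "?F z \<in> carrier (sum_group (insert i I) A)" if "z \<in> carrier (A i \<times>\<times> sum_group I A)" for z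
      using that by (cases z) (auto simp: carrier PiE_iff)
    then show "?F \<in> hom (A i \<times>\<times> sum_group I A) (sum_group (insert i I) A)"
      using assms(2) by (auto intro!: homI restrict_ext)
    show "bij_betw ?F (carrier (A i \<times>\<times> sum_group I A)) (carrier (sum_group (insert i I) A))"
    proof (rule bij_betw_byWitness[where f' = "\<lambda>x. (x i, restrict x I)"])
      show "\<forall>z\<in>carrier (A i \<times>\<times> sum_group I A). (?F z i, restrict (?F z) I) = z"
        using assms(2) by (fastforce simp: carrier PiE_iff extensional_def)
      show "\<forall>x\<in>carrier (sum_group (insert i I) A). ?F (x i, restrict x I) = x"
        by (auto simp: carrier PiE_iff extensional_def)
      show "(\<lambda>x. (x i, restrict x I)) ` carrier (sum_group (insert i I) A)
          \<subseteq> carrier (A i \<times>\<times> sum_group I A)"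
        by (auto simp: carrier PiE_iff)
    qed (use closed in blast)
  qed
  then show ?thesis by (rule is_isoI)
qed

text \<open>Converts a nested direct product into a \<open>sum_group\<close> one factor at a time,
  from the innermost outwards.\<close>

lemma Zmod_DirProd_sum_group:
  assumes "H \<cong> sum_group I (\<lambda>i. Zmod (m i))" "finite I" "i \<notin> I"
  shows "Zmod (m i) \<times>\<times> H \<cong> sum_group (insert i I) (\<lambda>i. Zmod (m i))"
proof -
  have "Zmod (m i) \<times>\<times> H \<cong> Zmod (m i) \<times>\<times> sum_group I (\<lambda>i. Zmod (m i))"
    by (intro group.DirProd_iso_trans iso_refl assms) simp
  also have "\<dots> \<cong> sum_group (insert i I) (\<lambda>i. Zmod (m i))"
    using assms(2,3) by (intro DirProd_iso_sum_group_insert) auto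
  finally show ?thesis .
qed

text \<open>An enumeration of \<open>I\<close> by \<open>{..<n}\<close> renames the coordinates. In
  the applications \<open>I\<close> is a set of index pairs.\<close>

lemma sum_group_const_iso_copies:
  assumes A: "\<And>i. i \<in> I \<Longrightarrow> A i = B" and "group B" "finite I" "card I = n"
  shows "sum_group I A \<cong> copies n B"
proof -
  obtain f where f: "bij_betw f {..<n} I"
    using ex_bij_betw_nat_finite[OF assms(3)] assms(4) by (auto simp: atLeast0LessThan)
  have carrier: "carrier (sum_group I A) = (\<Pi>\<^sub>E i\<in>I. carrier B)"
    "carrier (copies n B) = (\<Pi>\<^sub>E i\<in>{..<n}. carrier B)"
    using assms by (simp_all add: carrier_sum_group_finite copies_def cong: PiE_cong)
  have fI: "f k \<in> I" if "k < n" for k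
    using f that by (auto simp: bij_betw_def)
  have g: "inv_into {..<n} f i < n" "f (inv_into {..<n} f i) = i" if "i \<in> I" for i
    using f that bij_betw_inv_into[OF f] by (auto simp: bij_betw_def f_inv_into_f dest: inv_into_into)
  have gf: "inv_into {..<n} f (f k) = k" if "k < n" for k
    using f that by (auto simp: bij_betw_def)
  have "(\<lambda>x. \<lambda>k\<in>{..<n}. x (f k)) \<in> iso (sum_group I A) (copies n B)"
  proof (rule isoI)
    show "(\<lambda>x. \<lambda>k\<in>{..<n}. x (f k)) \<in> hom (sum_group I A) (copies n B)"
    proof (rule homI)
      show "(\<lambda>k\<in>{..<n}. x (f k)) \<in> carrier (copies n B)" if "x \<in> carrier (sum_group I A)" for x
        using that fI by (auto simp: carrier PiE_iff)
      show "(\<lambda>k\<in>{..<n}. (x \<otimes>\<^bsub>sum_group I A\<^esub> y) (f k))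
          = (\<lambda>k\<in>{..<n}. x (f k)) \<otimes>\<^bsub>copies n B\<^esub> (\<lambda>k\<in>{..<n}. y (f k))" for x y
        using fI A by (auto simp: copies_def)
    qed
    show "bij_betw (\<lambda>x. \<lambda>k\<in>{..<n}. x (f k)) (carrier (sum_group I A)) (carrier (copies n B))"
    proof (rule bij_betw_byWitness[where f' = "\<lambda>y. \<lambda>i\<in>I. y (inv_into {..<n} f i)"])
      show "\<forall>x\<in>carrier (sum_group I A). (\<lambda>i\<in>I. (\<lambda>k\<in>{..<n}. x (f k)) (inv_into {..<n} f i)) = x"
        using g by (auto simp: carrier PiE_iff extensional_def)
      show "\<forall>y\<in>carrier (copies n B). (\<lambda>k\<in>{..<n}. (\<lambda>i\<in>I. y (inv_into {..<n} f i)) (f k)) = y"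
        using fI gf by (auto simp: carrier PiE_iff extensional_def)
    qed (use fI g in \<open>auto simp: carrier PiE_iff split: if_splits\<close>)
  qed
  then show ?thesis by (rule is_isoI)
qed

section \<open>The abelian groups of order \<open>p ^ 5\<close>\<close>

text \<open>Pairs are sorted by their larger entry \<open>j\<close>, which leaves \<open>j\<close>
  choices for the smaller one.\<close>

lemma card_pairs_less: "card {(i, j). i \<in> {..<n} \<and> j \<in> {..<n} \<and> i < j} = n * (n - 1) div 2"
proof -
  have "{(i, j). i \<in> {..<n} \<and> j \<in> {..<n} \<and> i < j} = prod.swap ` (SIGMA j:{..<n}. {..<j})"
    by (auto simp: image_iff)
  then have "card {(i, j). i \<in> {..<n} \<and> j \<in> {..<n} \<and> i < j} = (\<Sum>j<n. j)"
    by (simp add: card_image)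
  also have "\<dots> = n * (n - 1) div 2"
    using Sum_Ico_nat[of 0 n] by (simp add: atLeast0LessThan)
  finally show ?thesis .
qed

lemma finite_pairs_less: "finite {(i, j). i \<in> {..<n :: nat} \<and> j \<in> {..<n} \<and> i < j}"
  by (rule finite_subset[of _ "{..<n} \<times> {..<n}"]) auto

text \<open>Covers the groups in which all pairs of cyclic factors have the same gcd; only the
  number of pairs then matters.\<close>

lemma exterior_square_copies:
  assumes "comm_group G" "G \<cong> sum_group {..<n} (\<lambda>i. Zmod (m i))"
    and gcd: "\<And>i j. i < j \<Longrightarrow> j < n \<Longrightarrow> gcd (m i) (m j) = q"
  shows "exterior_square G \<cong> copies (n * (n - 1) div 2) (Zmod q)"
proof -
  have "exterior_square G \<cong> sum_group {(i, j). i \<in> {..<n} \<and> j \<in> {..<n} \<and> i < j}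
      (\<lambda>(i, j). Zmod (gcd (m i) (m j)))"
    by (rule exterior_square_sum_group[OF assms(1) finite_lessThan assms(2)])
  also have "\<dots> \<cong> copies (n * (n - 1) div 2) (Zmod q)"
    using gcd by (intro sum_group_const_iso_copies finite_pairs_less card_pairs_less) auto
  finally show ?thesis .
qed

lemma exterior_square_rank_2:
  assumes "comm_group G" "G \<cong> Zmod k \<times>\<times> Zmod l"
  shows "exterior_square G \<cong> Zmod (gcd k l)"
proof -
  let ?m = "\<lambda>i::nat. if i = 0 then k else l"
  have "Zmod k \<times>\<times> Zmod l \<cong> sum_group (insert 0 {1}) (\<lambda>i. Zmod (?m i))"
    using Zmod_DirProd_sum_group[OF sum_group_singleton_iso[of "\<lambda>i. Zmod (?m i)" 1], of 0] by simp
  with assms(2) have "G \<cong> sum_group (insert 0 {1}) (\<lambda>i. Zmod (?m i))"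
    by (rule iso_trans)
  from exterior_square_sum_group[OF assms(1) _ this]
  have "exterior_square G \<cong> sum_group {(i, j). i \<in> {0, 1} \<and> j \<in> {0, 1} \<and> i < j}
      (\<lambda>(i, j). Zmod (gcd (?m i) (?m j)))"
    by simp
  also have "{(i, j). i \<in> {0, 1} \<and> j \<in> {0, 1} \<and> i < j} = {(0::nat, 1::nat)}"
    by auto
  also have "sum_group {(0::nat, 1::nat)} (\<lambda>(i, j). Zmod (gcd (?m i) (?m j))) \<cong> Zmod (gcd k l)"
    using group.iso_sym[OF _ sum_group_singleton_iso[of "\<lambda>(i, j). Zmod (gcd (?m i) (?m j))" "(0, 1)"]]
    by simp
  finally show ?thesis .
qed

theorem theorem4p2:
  fixes p :: nat and G :: "('a, 'b) monoid_scheme"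
  assumes "prime p" and "p > 3"
    and "comm_group G" and "order G dvd p ^ 5"
  shows
    "(G \<cong> Zmod (p ^ 5) \<longrightarrow> trivial_group (exterior_square G)) \<and>
     (G \<cong> Zmod (p ^ 3) \<times>\<times> Zmod (p ^ 2) \<longrightarrow> exterior_square G \<cong> Zmod (p ^ 2)) \<and>
     (G \<cong> Zmod (p ^ 4) \<times>\<times> Zmod p \<longrightarrow> exterior_square G \<cong> Zmod p) \<and>
     (G \<cong> Zmod (p ^ 2) \<times>\<times> Zmod (p ^ 2) \<times>\<times> Zmod p
        \<longrightarrow> exterior_square G \<cong> Zmod (p ^ 2) \<times>\<times> copies 2 (Zmod p)) \<and>
     (G \<cong> Zmod (p ^ 3) \<times>\<times> Zmod p \<times>\<times> Zmod p \<longrightarrow> exterior_square G \<cong> copies 3 (Zmod p)) \<and>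
     (G \<cong> Zmod (p ^ 2) \<times>\<times> Zmod p \<times>\<times> Zmod p \<times>\<times> Zmod p
        \<longrightarrow> exterior_square G \<cong> copies 6 (Zmod p)) \<and>
     (G \<cong> copies 5 (Zmod p) \<longrightarrow> exterior_square G \<cong> copies 10 (Zmod p))"
proof (intro conjI impI)
  note G = \<open>comm_group G\<close>
  interpret comm_group G by (rule G)
  assume "G \<cong> Zmod (p ^ 5)"
  also have "\<dots> \<cong> sum_group {0::nat} (\<lambda>_. Zmod (p ^ 5))"
    by (rule sum_group_singleton_iso) simp
  finally have "exterior_square G \<cong> sum_group {(i, j). i \<in> {0 :: nat} \<and> j \<in> {0} \<and> i < j}
      (\<lambda>(i, j). Zmod (gcd (p ^ 5) (p ^ 5)))"
    by (rule exterior_square_sum_group[OF G finite.insertI[OF finite.emptyI], where m = "\<lambda>_. p ^ 5"])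
  \<comment> \<open>A single index admits no pair \<open>i < j\<close>, so the sum is empty and the
    exterior square trivial.\<close>
  also have "{(i, j). i \<in> {0 :: nat} \<and> j \<in> {0} \<and> i < j} = ({} :: (nat \<times> nat) set)"
    by auto
  finally have iso: "exterior_square G \<cong> sum_group {} (\<lambda>(i :: nat, j :: nat). Zmod (gcd (p ^ 5) (p ^ 5)))" .
  show "trivial_group (exterior_square G)"
    by (subst isomorphic_group_triviality[OF iso group_ext])
      (simp_all add: trivial_group_def carrier_sum_group restrict_def)
next
  assume "G \<cong> Zmod (p ^ 3) \<times>\<times> Zmod (p ^ 2)"
  from exterior_square_rank_2[OF \<open>comm_group G\<close> this]
  show "exterior_square G \<cong> Zmod (p ^ 2)"
    by (simp add: gcd_nat.absorb2 le_imp_power_dvd)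
next
  assume "G \<cong> Zmod (p ^ 4) \<times>\<times> Zmod p"
  from exterior_square_rank_2[OF \<open>comm_group G\<close> this]
  show "exterior_square G \<cong> Zmod p"
    by (simp add: gcd_nat.absorb2)
next
  \<comment> \<open>Index 2 carries the factor of order \<open>p\<close>. The pair
    \<open>(0, 1)\<close> has gcd \<open>p ^ 2\<close> and is split off; the two pairs in
    \<open>?P\<close> involve index 2 and have gcd \<open>p\<close>.\<close>
  let ?m = "\<lambda>i::nat. if i = 2 then p else p ^ 2"
  let ?P = "{(0, 2), (1, 2)} :: (nat \<times> nat) set" and ?D = "\<lambda>(i, j). Zmod (gcd (?m i) (?m j))"
  assume "G \<cong> Zmod (p ^ 2) \<times>\<times> Zmod (p ^ 2) \<times>\<times> Zmod p"
  also have "\<dots> \<cong> sum_group {0, 1, 2} (\<lambda>i. Zmod (?m i))"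
    using Zmod_DirProd_sum_group[where m = ?m and i = 0, OF Zmod_DirProd_sum_group[where m = ?m and i = 1,
        OF sum_group_singleton_iso[of "\<lambda>i. Zmod (?m i)" 2]]] by simp
  finally have "exterior_square G \<cong> sum_group {(i, j). i \<in> {0, 1, 2} \<and> j \<in> {0, 1, 2} \<and> i < j} ?D"
    by (intro exterior_square_sum_group \<open>comm_group G\<close>) auto
  also have "{(i, j). i \<in> {0, 1, 2} \<and> j \<in> {0, 1, 2} \<and> i < j} = insert (0, 1) ?P"
    by auto
  also have "sum_group (insert (0, 1) ?P) ?D \<cong> Zmod (p ^ 2) \<times>\<times> sum_group ?P ?D"
  proof -
    have "?D (0, 1) \<times>\<times> sum_group ?P ?D \<cong> sum_group (insert (0, 1) ?P) ?D"
      by (rule DirProd_iso_sum_group_insert) auto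
    moreover have "group (?D (0, 1) \<times>\<times> sum_group ?P ?D)"
      by (intro DirProd_group sum_group) auto
    ultimately show ?thesis
      using group.iso_sym by fastforce
  qed
  also have "Zmod (p ^ 2) \<times>\<times> sum_group ?P ?D \<cong> Zmod (p ^ 2) \<times>\<times> copies 2 (Zmod p)"
    by (intro group.DirProd_iso_trans iso_refl sum_group_const_iso_copies)
      (auto simp: gcd_nat.absorb2)
  finally show "exterior_square G \<cong> Zmod (p ^ 2) \<times>\<times> copies 2 (Zmod p)" .
next
  \<comment> \<open>Only index 0 has a modulus other than \<open>p\<close>, so every pair contains
    an index with modulus \<open>p\<close> and all gcds equal \<open>p\<close>. The next case
    follows the same pattern with four indices.\<close>
  let ?m = "\<lambda>i::nat. if i = 0 then p ^ 3 else p"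
  assume "G \<cong> Zmod (p ^ 3) \<times>\<times> Zmod p \<times>\<times> Zmod p"
  also have "\<dots> \<cong> sum_group {0, 1, 2} (\<lambda>i. Zmod (?m i))"
    using Zmod_DirProd_sum_group[where m = ?m and i = 0, OF Zmod_DirProd_sum_group[where m = ?m and i = 1,
        OF sum_group_singleton_iso[of "\<lambda>i. Zmod (?m i)" 2]]] by simp
  also have "{0, 1, 2} = {..<3 :: nat}"
    by auto
  finally show "exterior_square G \<cong> copies 3 (Zmod p)"
    using exterior_square_copies[OF \<open>comm_group G\<close>, of 3 ?m p] by (simp add: gcd_nat.absorb2)
next
  let ?m = "\<lambda>i::nat. if i = 0 then p ^ 2 else p"
  assume "G \<cong> Zmod (p ^ 2) \<times>\<times> Zmod p \<times>\<times> Zmod p \<times>\<times> Zmod p"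
  also have "\<dots> \<cong> sum_group {0, 1, 2, 3} (\<lambda>i. Zmod (?m i))"
    using Zmod_DirProd_sum_group[where m = ?m and i = 0, OF Zmod_DirProd_sum_group[where m = ?m and i = 1,
        OF Zmod_DirProd_sum_group[where m = ?m and i = 2,
          OF sum_group_singleton_iso[of "\<lambda>i. Zmod (?m i)" 3]]]] by simp
  also have "{0, 1, 2, 3} = {..<4 :: nat}"
    by auto
  finally show "exterior_square G \<cong> copies 6 (Zmod p)"
    using exterior_square_copies[OF \<open>comm_group G\<close>, of 4 ?m p] by (simp add: gcd_nat.absorb2)
next
  assume "G \<cong> copies 5 (Zmod p)"
  then show "exterior_square G \<cong> copies 10 (Zmod p)"
    using exterior_square_copies[OF \<open>comm_group G\<close>, of 5 "\<lambda>_. p" p] by (simp add: copies_def)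
qed

end
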